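(* Let $\lambda\in(0,1)$ and let $x,y\in\mathbb{R}$ with $x\ne y$. Then the weighted geometric mean $$G_{x,y;\lambda}(t)=(x+t)^{\lambda}(y+t)^{1-\lambda}$$ is a Bernstein function of $t$ on the interval $(-\min\{x,y\},\infty)$.
   Context: A function $f$ is completely monotonic on an interval $I$ if it has derivatives of all orders on $I$ and $(-1)^n f^{(n)}(t)\ge 0$ for all $t\in I$ and all integers $n\ge 0$. A function $f:I\to[0,\infty)$ on an interval $I\subseteq(-\infty,\infty)$ is a Bernstein function on $I$ if it has derivatives of all orders on $I$ and $f'$ is completely monotonic on $I$. *)

theory Defs
  imports "HOL-Analysis.Analysis"
begin

text \<open>
  Derivatives are taken relative to the interval, hence one-sided at any endpoint it contains;
  at interior points \<^term>\<open>deriv_within\<close> is the ordinary derivative. On a set with an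
  isolated point, \<open>at t within I\<close> would be the trivial filter there, so the notions below
  demand an interval with more than one point.
\<close>

definition nondegenerate_interval :: "real set \<Rightarrow> bool" where
  "nondegenerate_interval I \<longleftrightarrow> is_interval I \<and> interior I \<noteq> {}"

definition deriv_within :: "real set \<Rightarrow> (real \<Rightarrow> real) \<Rightarrow> real \<Rightarrow> real" where
  "deriv_within I f t = vector_derivative f (at t within I)"

definition has_all_derivs_on :: "(real \<Rightarrow> real) \<Rightarrow> real set \<Rightarrow> bool" where
  "has_all_derivs_on f I \<longleftrightarrow> (\<forall>n. (deriv_within I ^^ n) f differentiable_on I)"

definition completely_monotonic_on :: "(real \<Rightarrow> real) \<Rightarrow> real set \<Rightarrow> bool" where
  "completely_monotonic_on f I \<longleftrightarrow>
     nondegenerate_interval I \<and> has_all_derivs_on f I \<and>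
     (\<forall>t\<in>I. \<forall>n. (-1) ^ n * (deriv_within I ^^ n) f t \<ge> 0)"

definition bernstein_on :: "(real \<Rightarrow> real) \<Rightarrow> real set \<Rightarrow> bool" where
  "bernstein_on f I \<longleftrightarrow>
     nondegenerate_interval I \<and> (\<forall>t\<in>I. f t \<ge> 0) \<and> has_all_derivs_on f I \<and>
     completely_monotonic_on (deriv_within I f) I"

definition weighted_geometric_mean :: "real \<Rightarrow> real \<Rightarrow> real \<Rightarrow> real \<Rightarrow> real" where
  "weighted_geometric_mean x y l t = (x + t) powr l * (y + t) powr (1 - l)"

lemma deriv_within_open:
  assumes "open I" "t \<in> I" "f differentiable (at t)"
  shows "deriv_within I f t = deriv f t"
proof -
  have "(f has_real_derivative deriv f t) (at t)"
    using assms(3) DERIV_deriv_iff_real_differentiable by blast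
  hence "(f has_vector_derivative deriv f t) (at t)"
    by (rule has_real_derivative_iff_has_vector_derivative[THEN iffD1])
  hence "vector_derivative f (at t) = deriv f t"
    by (rule vector_derivative_at)
  thus ?thesis
    unfolding deriv_within_def at_within_open[OF assms(2,1)] .
qed

end

theory Submission
  imports Defs
begin

text \<open>
  Put \<open>a = x + t\<close> and \<open>b = y + t\<close>. Differentiating \<open>a\<^sup>l b\<^sup>1\<^sup>-\<^sup>l\<close> twice, the three terms combine to
  \<open>- l (1 - l) (x - y)\<^sup>2 a\<^sup>l\<^sup>-\<^sup>2 b\<^sup>-\<^sup>l\<^sup>-\<^sup>1\<close>. Both exponents are now negative, and a product of negative
  powers is completely monotonic; the first derivative is visibly nonnegative.
\<close>

text \<open>The induction hypothesis gives equality throughout \<open>I\<close>; as \<open>I\<close>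
  is open, this is equality near \<open>t\<close>, which is what transferring a derivative
  requires.\<close>

lemma funpow_deriv_within_eq:
  fixes F :: "nat \<Rightarrow> real \<Rightarrow> real"
  assumes "open I" and F: "\<And>n t. t \<in> I \<Longrightarrow> (F n has_real_derivative F (Suc n) t) (at t)"
    and "t \<in> I"
  shows "(deriv_within I ^^ n) (F 0) t = F n t"
  using \<open>t \<in> I\<close>
proof (induction n arbitrary: t)
  case 0
  show ?case by simp
next
  case (Suc n)
  have "((deriv_within I ^^ n) (F 0) has_real_derivative F (Suc n) t) (at t)"
    using F[OF Suc.prems] \<open>open I\<close> Suc.prems
    by (rule has_field_derivative_transform_within_open) (simp add: Suc.IH)
  then show ?case
    using deriv_within_open[OF \<open>open I\<close> Suc.prems]
    by (metis DERIV_imp_deriv comp_apply funpow.simps(2) real_differentiable_def)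
qed

lemma has_all_derivs_on_if_derivatives:
  fixes F :: "nat \<Rightarrow> real \<Rightarrow> real"
  assumes "open I" and F: "\<And>n t. t \<in> I \<Longrightarrow> (F n has_real_derivative F (Suc n) t) (at t)"
  shows "has_all_derivs_on (F 0) I"
  unfolding has_all_derivs_on_def differentiable_on_def
proof (intro allI ballI)
  fix n t assume "t \<in> I"
  have "((deriv_within I ^^ n) (F 0) has_real_derivative F (Suc n) t) (at t)"
    using F[OF \<open>t \<in> I\<close>] \<open>open I\<close> \<open>t \<in> I\<close>
    by (rule has_field_derivative_transform_within_open) (simp add: funpow_deriv_within_eq[where F = F, OF assms])
  then show "(deriv_within I ^^ n) (F 0) differentiable at t within I"
    using differentiable_at_withinI real_differentiable_def by blast
qed

lemma has_all_derivs_on_deriv_within: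
  "has_all_derivs_on f I \<Longrightarrow> has_all_derivs_on (deriv_within I f) I"
  unfolding has_all_derivs_on_def by (metis comp_apply funpow_Suc_right)

text \<open>Trades the iterates of \<open>deriv_within\<close> for an explicit family. The sign
  condition is shifted to \<open>Suc n\<close> because complete monotonicity is asked of the
  derivative.\<close>

lemma bernstein_on_if_derivatives:
  fixes F :: "nat \<Rightarrow> real \<Rightarrow> real"
  assumes "nondegenerate_interval I" "open I"
    and F: "\<And>n t. t \<in> I \<Longrightarrow> (F n has_real_derivative F (Suc n) t) (at t)"
    and "\<And>t. t \<in> I \<Longrightarrow> 0 \<le> F 0 t"
    and "\<And>n t. t \<in> I \<Longrightarrow> 0 \<le> (-1) ^ n * F (Suc n) t"
  shows "bernstein_on (F 0) I"
proof -
  have "(deriv_within I ^^ n) (deriv_within I (F 0)) t = F (Suc n) t" if "t \<in> I" for n t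
    using funpow_deriv_within_eq[where F = F and n = "Suc n", OF assms(2) F that]
    by (simp add: funpow_swap1)
  with assms has_all_derivs_on_if_derivatives[where F = F, OF assms(2) F] show ?thesis
    by (simp add: bernstein_on_def completely_monotonic_on_def has_all_derivs_on_deriv_within)
qed

text \<open>\<open>powr_prod_deriv x y n p q\<close> is the \<open>n\<close>-th derivative of \<open>(x + t)\<^sup>p (y + t)\<^sup>q\<close>.\<close>

fun powr_prod_deriv :: "real \<Rightarrow> real \<Rightarrow> nat \<Rightarrow> real \<Rightarrow> real \<Rightarrow> real \<Rightarrow> real" where
  "powr_prod_deriv x y 0 p q t = (x + t) powr p * (y + t) powr q"
| "powr_prod_deriv x y (Suc n) p q t =
     p * powr_prod_deriv x y n (p - 1) q t + q * powr_prod_deriv x y n p (q - 1) t"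

text \<open>The recursion peels off the earliest differentiation, so the induction step meets
  shifted exponents and \<open>p\<close>, \<open>q\<close> must stay arbitrary.\<close>

lemma DERIV_powr_prod_deriv:
  assumes "0 < x + t" "0 < y + t"
  shows "(powr_prod_deriv x y n p q has_real_derivative powr_prod_deriv x y (Suc n) p q t) (at t)"
proof (induction n arbitrary: p q)
  case 0
  have "((\<lambda>t. (x + t) powr p * (y + t) powr q) has_real_derivative
      powr_prod_deriv x y (Suc 0) p q t) (at t)"
    using assms by (auto intro!: derivative_eq_intros)
  moreover have "powr_prod_deriv x y 0 p q = (\<lambda>t. (x + t) powr p * (y + t) powr q)"
    by (simp add: fun_eq_iff)
  ultimately show ?case by simp
next
  case (Suc n)
  have "((\<lambda>t. p * powr_prod_deriv x y n (p - 1) q t + q * powr_prod_deriv x y n p (q - 1) t)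
      has_real_derivative powr_prod_deriv x y (Suc (Suc n)) p q t) (at t)"
    unfolding powr_prod_deriv.simps(2)[of x y "Suc n"]
    by (intro DERIV_add DERIV_cmult Suc.IH)
  then show ?case by simp
qed

text \<open>The \<open>n\<close>-th derivative of \<open>a\<^sup>p\<^sup>+\<^sup>1 b\<^sup>q - a\<^sup>p b\<^sup>q\<^sup>+\<^sup>1 = (a - b) a\<^sup>p b\<^sup>q\<close>, where \<open>a - b = x - y\<close> is constant.\<close>

lemma powr_prod_deriv_diff:
  assumes "0 < x + t" "0 < y + t"
  shows "powr_prod_deriv x y n (p + 1) q t - powr_prod_deriv x y n p (q + 1) t =
    (x - y) * powr_prod_deriv x y n p q t"
proof (induction n arbitrary: p q)
  case 0
  then show ?case using assms by (simp add: powr_add algebra_simps)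
next
  case (Suc n)
  \<comment> \<open>Weight the two hypotheses by \<open>p\<close> and \<open>q\<close>; the extra
    terms from the coefficients \<open>p + 1\<close> and \<open>q + 1\<close> cancel.\<close>
  show ?case
    using Suc.IH[of "p - 1" q] Suc.IH[of p "q - 1"] by simp algebra
qed

text \<open>Each differentiation brings down a nonpositive exponent and lowers it by one, so the
  sign alternates and the hypotheses persist.\<close>

lemma powr_prod_deriv_sign:
  assumes "p \<le> 0" "q \<le> 0"
  shows "0 \<le> (-1) ^ n * powr_prod_deriv x y n p q t"
  using assms
proof (induction n arbitrary: p q)
  case 0
  then show ?case by simp
next
  case (Suc n)
  have "0 \<le> (- p) * ((-1) ^ n * powr_prod_deriv x y n (p - 1) q t)"
    and "0 \<le> (- q) * ((-1) ^ n * powr_prod_deriv x y n p (q - 1) t)"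
    by (rule mult_nonneg_nonneg; use Suc in simp)+
  then show ?case by (simp add: algebra_simps)
qed

text \<open>Since the exponents sum to 1, two differentiations leave \<open>- (l * (1 - l))\<close>
  times a second difference over exponent pairs of sum -1. Each of its two differencings pulls out a
  factor \<open>x - y\<close>.\<close>

lemma powr_prod_deriv_weighted_Suc_Suc:
  assumes "0 < x + t" "0 < y + t"
  shows "powr_prod_deriv x y (Suc (Suc n)) l (1 - l) t =
    - (l * (1 - l) * (x - y)\<^sup>2 * powr_prod_deriv x y n (l - 2) (- l - 1) t)"
proof -
  note diff = powr_prod_deriv_diff[OF assms, of n]
  have "powr_prod_deriv x y n (l - 1) (- l) t - powr_prod_deriv x y n (l - 2) (1 - l) t =
      (x - y) * powr_prod_deriv x y n (l - 2) (- l) t"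
    using diff[of "l - 2" "- l"] by simp
  moreover have "powr_prod_deriv x y n l (- l - 1) t - powr_prod_deriv x y n (l - 1) (- l) t =
      (x - y) * powr_prod_deriv x y n (l - 1) (- l - 1) t"
    using diff[of "l - 1" "- l - 1"] by simp
  moreover have "powr_prod_deriv x y n (l - 1) (- l - 1) t - powr_prod_deriv x y n (l - 2) (- l) t =
      (x - y) * powr_prod_deriv x y n (l - 2) (- l - 1) t"
    using diff[of "l - 2" "- l - 1"] by simp
  moreover have "powr_prod_deriv x y (Suc (Suc n)) l (1 - l) t = - (l * (1 - l)) *
      (powr_prod_deriv x y n (l - 2) (1 - l) t - 2 * powr_prod_deriv x y n (l - 1) (- l) t
        + powr_prod_deriv x y n l (- l - 1) t)"
    by (simp add: algebra_simps)
  ultimately show ?thesis by algebra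
qed

lemma powr_prod_deriv_weighted_sign:
  assumes "0 < l" "l < 1" "0 < x + t" "0 < y + t"
  shows "0 \<le> (-1) ^ n * powr_prod_deriv x y (Suc n) l (1 - l) t"
\<comment> \<open>The closed form starts at the second derivative; the first has the nonnegative
  coefficients \<open>l\<close> and \<open>1 - l\<close>.\<close>
proof (cases n)
  case 0
  then show ?thesis using assms by simp
next
  case (Suc m)
  have "0 \<le> (l * (1 - l) * (x - y)\<^sup>2) * ((-1) ^ m * powr_prod_deriv x y m (l - 2) (- l - 1) t)"
    using assms by (intro mult_nonneg_nonneg powr_prod_deriv_sign) auto
  then show ?thesis
    unfolding Suc powr_prod_deriv_weighted_Suc_Suc[OF assms(3,4)] by (simp add: mult_ac)
qed

theorem theorem3p1:
  fixes l x y :: real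
  assumes "0 < l" and "l < 1" and "x \<noteq> y"
  shows "bernstein_on (weighted_geometric_mean x y l) {- min x y <..}"
proof -
  have pos: "0 < x + t" "0 < y + t" if "t \<in> {- min x y <..}" for t
    using that by auto
  have "nondegenerate_interval {- min x y <..}"
    by (simp add: nondegenerate_interval_def is_interval_oi interior_open)
  \<comment> \<open>The goal shows only the member \<open>F 0\<close>, so the whole family is
    supplied explicitly.\<close>
  then have "bernstein_on (powr_prod_deriv x y 0 l (1 - l)) {- min x y <..}"
    using assms pos
    by (intro bernstein_on_if_derivatives[where F = "\<lambda>n. powr_prod_deriv x y n l (1 - l)"])
      (simp_all only: DERIV_powr_prod_deriv powr_prod_deriv_weighted_sign open_greaterThan, simp_all)
  moreover have "powr_prod_deriv x y 0 l (1 - l) = weighted_geometric_mean x y l"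
    by (simp add: fun_eq_iff weighted_geometric_mean_def)
  ultimately show ?thesis by simp
qed

end
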